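(* Let $G$ be a connected graph with cyclomatic number $k\ge 1$. Then $H(G)\ge r(G)-\frac{31}{105}(k-1)$. In particular, $H(G)>r(G)-1$ for every connected graph $G$ with cyclomatic number $k$ satisfying $1\le k\le 4$.
   Context: Graphs are finite, simple and undirected. The cyclomatic number of $G$ is $k=|E(G)|-|V(G)|+1$. For a graph $G$ with vertex degrees $d_i=\deg(v_i)$, the Harmonic index is $H(G)=\sum_{v_iv_j\in E(G)} \frac{2}{d_i+d_j}$, the sum being over all edges. The radius $r(G)=\min_{v_i\in V}\max_{v_j\in V}\rho(v_i,v_j)$, where $\rho$ is the shortest-path distance. *)

theory Defs
  imports "Graph_Theory.Graph_Theory"
begin

text \<open>
  A finite simple undirected graph is a \<^locale>\<open>pair_graph\<close>: a finite loop-free digraph whose arc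
  relation is symmetric. Each undirected edge is thus stored as two opposite arcs, so edges
  have to be counted and summed over as unordered pairs, and the degree of a vertex is its
  out-degree.
\<close>

definition uedges :: "'a pair_pre_digraph \<Rightarrow> 'a set set" where
  "uedges G = {{u, v} | u v. (u, v) \<in> parcs G}"

definition cyclomatic_number :: "'a pair_pre_digraph \<Rightarrow> int" where
  "cyclomatic_number G = int (card (uedges G)) - int (card (pverts G)) + 1"

text \<open>For an edge \<open>e = {u, v}\<close> without loops, the inner sum is \<open>deg u + deg v\<close>.\<close>

definition harmonic_index :: "'a pair_pre_digraph \<Rightarrow> real" where
  "harmonic_index G = (\<Sum>e\<in>uedges G. 2 / (\<Sum>v\<in>e. real (out_degree G v)))"

text \<open>
  The infimum of the lengths of all walks is taken in \<^typ>\<open>ereal\<close>; it is a natural number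
  whenever the two vertices are connected, which is the only case that is used.
\<close>

definition graph_dist :: "'a pair_pre_digraph \<Rightarrow> 'a \<Rightarrow> 'a \<Rightarrow> real" where
  "graph_dist G u v = real_of_ereal (wf_digraph.\<mu> G (\<lambda>_. 1) u v)"

definition graph_radius :: "'a pair_pre_digraph \<Rightarrow> real" where
  "graph_radius G =
    Min ((\<lambda>u. Max ((\<lambda>v. graph_dist G u v) ` pverts G)) ` pverts G)"

end

theory Submission
  imports Defs
begin

text \<open>
  Write \<open>H\<close> as a sum over arcs. Restoring an edge \<open>uv\<close> to a graph in which \<open>u\<close> and \<open>v\<close> are
  already connected lowers \<open>H\<close> by at most \<open>31/105\<close>: both ends have a neighbour of degree at least 2,
  and the worst case has both ends of degree 5. Deleting edges does not decrease the radius, so it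
  suffices to show \<open>H \<ge> r\<close> for a connected spanning unicyclic subgraph.

  Choose an edge \<open>ab\<close> that is not a bridge and a breadth-first tree of the rest rooted at \<open>a\<close>. The
  parent map, extended by \<open>a \<mapsto> b\<close>, is a function \<open>f\<close> whose graph is unicyclic, with every vertex
  flowing into the cycle. \<open>H\<close> grows under adding leaves: by at least \<open>1/2\<close> when a pendant path is
  prolonged and by at least \<open>3/10\<close> for the first leaf at a vertex of the cycle. Hence a cycle of
  length \<open>g\<close> with pendant paths of lengths \<open>h_i\<close> at distinct vertices gives
  \<open>H \<ge> g/2 + \<Sum> (h_i/2 - 1/5)\<close>.

  Let \<open>x\<close> be a vertex of maximal height above the cycle. Take the vertex at distance \<open>r - 1\<close> from \<open>x\<close>
  on its way down, or the foot of \<open>x\<close> on the cycle if \<open>x\<close> is too low, and a vertex \<open>w\<close> at distance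
  at least \<open>r\<close> from it. The cycle and the paths of \<open>x\<close> and \<open>w\<close> together have more than \<open>2r\<close> vertices,
  and the estimate gives \<open>H \<ge> r\<close>, except possibly when \<open>g\<close> is even and every cycle vertex carries
  a path of the same length; then all \<open>g\<close> paths are used.
\<close>

section \<open>Adding an edge\<close>

definition deg :: "('a \<times> 'a) set \<Rightarrow> 'a \<Rightarrow> nat" where
  "deg A u = card (A `` {u})"

text \<open>A symmetric \<open>A\<close> holds each edge as two arcs, hence the numerator 1 in place
  of 2.\<close>

definition hsum :: "('a \<times> 'a) set \<Rightarrow> real" where
  "hsum A = (\<Sum>(x, y)\<in>A. 1 / (real (deg A x) + real (deg A y)))"

definition add_edge :: "'a \<Rightarrow> 'a \<Rightarrow> ('a \<times> 'a) set \<Rightarrow> ('a \<times> 'a) set" where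
  "add_edge u v A = insert (u, v) (insert (v, u) A)"

lemma hsum_nonneg: "0 \<le> hsum A"
  unfolding hsum_def by (auto intro!: sum_nonneg)

lemma finite_Image_singleton: "finite A \<Longrightarrow> finite (A `` {u})"
  by (simp add: finite_Image)

lemma deg_pos: "finite A \<Longrightarrow> (u, v) \<in> A \<Longrightarrow> 1 \<le> deg A u"
  unfolding deg_def by (metis Image_singleton_iff One_nat_def Suc_leI card_gt_0_iff empty_iff
      finite_Image_singleton)

lemma deg_ge2:
  assumes "finite A" "(u, x) \<in> A" "(u, y) \<in> A" "x \<noteq> y"
  shows "2 \<le> deg A u"
proof -
  have "card {x, y} \<le> card (A `` {u})"
    using assms by (intro card_mono finite_Image_singleton) auto
  then show ?thesis using assms by (simp add: deg_def)
qed

lemma deg_add_edge: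
  assumes "finite A" "(u, v) \<notin> A" "u \<noteq> v" "sym A"
  shows "deg (add_edge u v A) x = (if x = u \<or> x = v then Suc (deg A x) else deg A x)"
proof -
  have *: "(v, u) \<notin> A" using assms by (auto dest: symD)
  have 1: "add_edge u v A `` {u} = insert v (A `` {u})"
    "add_edge u v A `` {v} = insert u (A `` {v})"
    using assms by (auto simp: add_edge_def)
  have 2: "x \<noteq> u \<Longrightarrow> x \<noteq> v \<Longrightarrow> add_edge u v A `` {x} = A `` {x}"
    by (auto simp: add_edge_def)
  show ?thesis
    using 1 2 * assms by (auto simp: deg_def card_insert_if finite_Image_singleton)
qed

lemma sum_arcs_from:
  fixes w :: "'a \<Rightarrow> real"
  assumes "finite A"
  shows "(\<Sum>(x, y)\<in>A. if x = u then w y else 0) = (\<Sum>y\<in>A `` {u}. w y)"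
proof -
  have "(\<Sum>(x, y)\<in>A. if x = u then w y else 0) = (\<Sum>p\<in>{p\<in>A. fst p = u}. w (snd p))"
    using assms by (subst sum.inter_filter) (auto simp: case_prod_unfold)
  also have "\<dots> = (\<Sum>y\<in>A `` {u}. w y)"
    by (rule sum.reindex_bij_witness[of _ "\<lambda>y. (u, y)" snd]) auto
  finally show ?thesis .
qed

lemma sum_arcs_to:
  fixes w :: "'a \<Rightarrow> real"
  assumes "finite A" "sym A"
  shows "(\<Sum>(x, y)\<in>A. if y = u then w x else 0) = (\<Sum>y\<in>A `` {u}. w y)"
proof -
  have "(\<Sum>(x, y)\<in>A. if y = u then w x else 0) = (\<Sum>(x, y)\<in>A. if x = u then w y else 0)"
    using assms by (intro sum.reindex_bij_witness[of _ prod.swap prod.swap]) (auto dest: symD)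
  then show ?thesis using sum_arcs_from[OF assms(1)] by simp
qed

text \<open>The new edge contributes its own weight, and an old arc with an end at \<open>u\<close>
  or \<open>v\<close> drops from \<open>1 / p\<close> to \<open>1 / (p + 1)\<close>. The factors 2
  account for arcs leaving and arcs entering.\<close>

lemma hsum_add_edge:
  assumes "finite A" "sym A" "irrefl A" "(u, v) \<notin> A" "u \<noteq> v"
  defines "t \<equiv> \<lambda>w x. 1 / ((real (deg A w) + real (deg A x)) * (real (deg A w) + real (deg A x) + 1))"
  shows "hsum (add_edge u v A) = hsum A + 2 / (real (deg A u) + real (deg A v) + 2)
    - 2 * (\<Sum>x\<in>A `` {u}. t u x) - 2 * (\<Sum>x\<in>A `` {v}. t v x)"
proof -
  let ?B = "add_edge u v A"
  let ?g = "\<lambda>x y. 1 / (real (deg ?B x) + real (deg ?B y))"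
  have vu: "(v, u) \<notin> A" using assms by (auto dest: symD)
  note dB = deg_add_edge[OF assms(1,4,5,2)]
  have "hsum ?B = (\<Sum>(x, y)\<in>A. ?g x y) + (?g u v + ?g v u)"
    unfolding hsum_def using assms vu by (subst (3) add_edge_def) (auto)
  also have "?g u v + ?g v u = 2 / (real (deg A u) + real (deg A v) + 2)"
    using assms by (simp add: dB add_ac)
  finally have 1: "hsum ?B = (\<Sum>(x, y)\<in>A. ?g x y) + 2 / (real (deg A u) + real (deg A v) + 2)" .
  have pt: "1 / (real (deg A x) + real (deg A y)) - ?g x y =
      (if x = u then t u y else 0) + (if y = u then t u x else 0)
      + ((if x = v then t v y else 0) + (if y = v then t v x else 0))"
    if xy: "(x, y) \<in> A" for x y
  proof -
    have yx: "(y, x) \<in> A" using xy assms(2) by (auto dest: symD)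
    have ne: "x \<noteq> y" using xy assms(3) by (auto simp: irrefl_def)
    have p: "1 / p - 1 / (p + 1) = 1 / (p * (p + 1))" if "p \<ge> 1" for p :: real
      using that by (simp add: field_simps)
    have "1 \<le> deg A x" "1 \<le> deg A y" using deg_pos[OF assms(1)] xy yx by auto
    then have ge: "real (deg A x) + real (deg A y) \<ge> 1" by linarith
    \<comment> \<open>Old arcs have at most one end among \<open>u\<close> and \<open>v\<close>, so
      their degree sums grow by at most 1.\<close>
    have not: "\<not> (x = u \<and> y = v)" "\<not> (x = v \<and> y = u)" using xy vu assms by auto
    show ?thesis
      using not ne assms(5) p[OF ge] unfolding dB t_def
      by (auto simp: add_ac mult_ac)
  qed
  have "hsum A - (\<Sum>(x, y)\<in>A. ?g x y)
    = (\<Sum>(x, y)\<in>A. 1 / (real (deg A x) + real (deg A y)) - ?g x y)"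
    unfolding hsum_def by (simp add: sum_subtractf case_prod_unfold)
  also have "\<dots> = (\<Sum>(x, y)\<in>A. (if x = u then t u y else 0) + (if y = u then t u x else 0)
      + ((if x = v then t v y else 0) + (if y = v then t v x else 0)))"
    by (rule sum.cong) (use pt in auto)
  also have "\<dots> = (\<Sum>(x, y)\<in>A. if x = u then t u y else 0) + (\<Sum>(x, y)\<in>A. if y = u then t u x else 0)
     + ((\<Sum>(x, y)\<in>A. if x = v then t v y else 0) + (\<Sum>(x, y)\<in>A. if y = v then t v x else 0))"
    by (simp add: sum.distrib case_prod_unfold)
  also have "\<dots> = 2 * (\<Sum>x\<in>A `` {u}. t u x) + 2 * (\<Sum>x\<in>A `` {v}. t v x)"
    using sum_arcs_from[OF assms(1)] sum_arcs_to[OF assms(1,2)] by simp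
  finally show ?thesis using 1 by linarith
qed

lemma hsum_add_leaf:
  assumes "finite A" "sym A" "irrefl A" "A `` {v} = {}" "u \<noteq> v"
  shows "hsum (add_edge u v A) = hsum A + 2 / (real (deg A u) + 2)
    - 2 * (\<Sum>x\<in>A `` {u}. 1 / ((real (deg A u) + real (deg A x)) * (real (deg A u) + real (deg A x) + 1)))"
proof -
  have "(u, v) \<notin> A" using assms by (auto dest: symD)
  moreover have "deg A v = 0" using assms by (simp add: deg_def)
  ultimately show ?thesis using hsum_add_edge[of A u v] assms by simp
qed

text \<open>The loss at a neighbour decreases with its degree, so a common lower bound
  \<open>k\<close> may replace all neighbour degrees.\<close>

lemma hsum_add_leaf_ge:
  assumes "finite A" "sym A" "irrefl A" "A `` {v} = {}" "u \<noteq> v"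
    and k: "\<And>x. (u, x) \<in> A \<Longrightarrow> k \<le> deg A x"
    and d: "1 \<le> deg A u"
  shows "hsum (add_edge u v A) \<ge> hsum A + 2 / (real (deg A u) + 2)
    - 2 * real (deg A u) / ((real (deg A u) + real k) * (real (deg A u) + real k + 1))"
proof -
  let ?t = "\<lambda>x. 1 / ((real (deg A u) + real x) * (real (deg A u) + real x + 1))"
  have "?t (deg A x) \<le> ?t k" if "x \<in> A `` {u}" for x
    using k[of x] that d by (intro divide_left_mono mult_mono mult_pos_pos) auto
  then have "(\<Sum>x\<in>A `` {u}. ?t (deg A x)) \<le> real (card (A `` {u})) * ?t k"
    by (intro sum_bounded_above) auto
  then show ?thesis
    using hsum_add_leaf[OF assms(1-5)] by (simp add: deg_def)
qed

text \<open>Half the loss at an endpoint of new degree \<open>a\<close> when one of its old neighbours has degree at least 2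
  and the others may be leaves.\<close>

definition drop_bound :: "real \<Rightarrow> real" where
  "drop_bound a = (a - 2) / (a * (a + 1)) + 1 / ((a + 1) * (a + 2))"

lemma drop_bound_le_inverse:
  assumes "2 \<le> a"
  shows "drop_bound a \<le> 1 / (a + 2)"
proof -
  have "a \<noteq> 0" "a + 1 \<noteq> 0" "a + 2 \<noteq> 0" using assms by auto
  then have "drop_bound a = 1 / (a + 2) - 4 / (a * (a + 1) * (a + 2))"
    unfolding drop_bound_def by (simp add: divide_simps) (simp add: algebra_simps)
  then show ?thesis using assms by simp
qed

text \<open>Replace \<open>drop_bound a\<close> by \<open>1 / (a + 2)\<close>. Its excess over
  \<open>1 / (a + b)\<close> has a bound that decreases in \<open>a\<close>, so \<open>a\<close> may
  be lowered: to \<open>b\<close> if \<open>b\<close> is at least 8, and to 8 or 9 for the finitely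
  many smaller \<open>b\<close>.\<close>

lemma drop_bound_large:
  fixes a b :: nat
  assumes "8 \<le> a" "2 \<le> b" "b \<le> a"
  shows "drop_bound a + drop_bound b \<le> 31 / 210 + 1 / (a + b)"
proof -
  have A: "real a \<ge> 8" using assms by simp
  have *: "drop_bound a - 1 / (real a + real b) \<le> (real b - 2) / ((real a + 2) * (real a + real b))"
  proof -
    have "1 / (real a + 2) - 1 / (real a + real b) = (real b - 2) / ((real a + 2) * (real a + real b))"
      using A assms(2) by (simp add: divide_simps)
    then show ?thesis using drop_bound_le_inverse[of "real a"] A by linarith
  qed
  have dec: "drop_bound a - 1 / (real a + real b) \<le> (real b - 2) / ((c + 2) * (c + real b))"
    if "c \<le> a" "0 \<le> c" for c :: real
    by (rule order.trans[OF *]) (use that assms in \<open>auto intro!: divide_left_mono mult_mono\<close>)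
  show ?thesis
  proof (cases "8 \<le> b")
    case True
    have "(real b - 2) / ((real b + 2) * (real b + real b)) + 1 / (real b + 2) \<le> 31 / 210"
    proof -
      have "(real b - 2) / ((real b + 2) * (real b + real b)) + 1 / (real b + 2)
        = (3 * real b - 2) / (2 * real b * (real b + 2))"
      proof -
        have "real b \<noteq> 0" "real b + 2 \<noteq> 0" using True by auto
        then show ?thesis by (simp add: divide_simps)
      qed
      also have "\<dots> \<le> 31 / 210"
      proof -
        \<comment> \<open>The tangent of the square at 8 makes the inequality linear in
          \<open>b\<close>.\<close>
        have "16 * real b - 64 \<le> real b * real b"
          using zero_le_power2[of "real b - 8"] by (simp add: power2_eq_square algebra_simps)
        moreover have "8 \<le> real b" "0 < 2 * real b * (real b + 2)" using True by simp_all
        ultimately show ?thesis by (simp add: pos_divide_le_eq algebra_simps)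
      qed
      finally show ?thesis .
    qed
    moreover have "drop_bound a - 1 / (real a + real b)
        \<le> (real b - 2) / ((real b + 2) * (real b + real b))"
      using assms by (intro dec) auto
    moreover have "drop_bound b \<le> 1 / (real b + 2)"
      using assms by (intro drop_bound_le_inverse) auto
    ultimately show ?thesis unfolding of_nat_add by linarith
  next
    case False
    then have "b \<in> {2,3,4,5,6,7}" using assms by auto
    \<comment> \<open>Lowering \<open>a\<close> to 8 fails only for \<open>b = 4\<close>; there
      \<open>a = 8\<close> is computed directly and \<open>c = 9\<close> serves for larger
      \<open>a\<close>.\<close>
    then have "(b = 4 \<and> a = 8) \<or> (\<exists>c\<in>{8, 9}. c \<le> real a
        \<and> (real b - 2) / ((c + 2) * (c + real b)) + drop_bound b \<le> 31 / 210)"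
      using assms by (auto simp: drop_bound_def)
    then show ?thesis
    proof
      assume "b = 4 \<and> a = 8"
      then show ?thesis by (simp add: drop_bound_def)
    next
      assume "\<exists>c\<in>{8, 9}. c \<le> real a
        \<and> (real b - 2) / ((c + 2) * (c + real b)) + drop_bound b \<le> 31 / 210"
      then obtain c where c: "c \<in> {8, 9}" "c \<le> real a"
        "(real b - 2) / ((c + 2) * (c + real b)) + drop_bound b \<le> 31 / 210" by blast
      moreover have "0 \<le> c" using c(1) by auto
      ultimately show ?thesis using dec[of c] unfolding of_nat_add by linarith
    qed
  qed
qed

text \<open>The maximum is at \<open>a = b = 5\<close>; for small arguments the tangent of \<open>1 / s\<close> at \<open>s = 10\<close>
  decouples \<open>a\<close> from \<open>b\<close>.\<close>

lemma drop_bound_sum: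
  fixes a b :: nat
  assumes "2 \<le> a" "2 \<le> b"
  shows "drop_bound a + drop_bound b \<le> 31 / 210 + 1 / (a + b)"
proof (cases "8 \<le> a \<or> 8 \<le> b")
  case True
  then show ?thesis
    using drop_bound_large[of a b] drop_bound_large[of b a] assms
    by (cases "b \<le> a") (auto simp: add_ac)
next
  case False
  \<comment> \<open>Half of \<open>31 / 210\<close> plus half of the tangent value at
    \<open>a = b = n\<close>. Equality at \<open>n = 5\<close> is the origin of the constant
    31.\<close>
  have small: "drop_bound n \<le> 31 / 420 + (10 - real n) / 100" if "2 \<le> n" "n < 8" for n :: nat
  proof -
    have "n \<in> {2,3,4,5,6,7}" using that by auto
    then show ?thesis by (auto simp: drop_bound_def)
  qed
  have "(20 - s) / 100 \<le> 1 / s" if "s > 0" for s :: real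
  proof -
    have "0 \<le> (s - 10)\<^sup>2" by simp
    then show ?thesis using that by (simp add: field_simps power2_eq_square)
  qed
  from this[of "real a + real b"] show ?thesis
    using small[of a] small[of b] False assms by (simp add: diff_divide_distrib add_divide_distrib)
qed

text \<open>The worst case: \<open>y\<close> counts with degree 2 and all other neighbours with
  degree 1.\<close>

lemma neighbour_sum_le_drop_bound:
  assumes "finite A" "sym A" "(u, y) \<in> A" "2 \<le> deg A y"
  shows "(\<Sum>x\<in>A `` {u}. 1 / ((real (deg A u) + real (deg A x)) * (real (deg A u) + real (deg A x) + 1)))
    \<le> drop_bound (real (deg A u) + 1)"
proof -
  let ?d = "real (deg A u)"
  let ?t = "\<lambda>x. 1 / ((?d + x) * (?d + x + 1))"
  have fin: "finite (A `` {u})" and y: "y \<in> A `` {u}" using assms by (auto intro: finite_Image_singleton)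
  have d: "1 \<le> ?d" using deg_pos[OF assms(1,3)] by simp
  have "?t (real (deg A x)) \<le> ?t 1" if "x \<in> A `` {u} - {y}" for x
  proof -
    have "1 \<le> deg A x" using that deg_pos[OF assms(1), of x u] assms(2) by (auto dest: symD)
    then show ?thesis using d by (intro divide_left_mono mult_mono mult_pos_pos) auto
  qed
  then have "(\<Sum>x\<in>A `` {u} - {y}. ?t (real (deg A x))) \<le> real (card (A `` {u} - {y})) * ?t 1"
    by (intro sum_bounded_above) auto
  moreover have "real (card (A `` {u} - {y})) = ?d - 1"
    using fin y d by (simp add: deg_def of_nat_diff)
  moreover have "?t (real (deg A y)) \<le> ?t 2"
    using assms(4) d by (intro divide_left_mono mult_mono mult_pos_pos) auto
  ultimately have "(\<Sum>x\<in>A `` {u}. ?t (real (deg A x))) \<le> (?d - 1) * ?t 1 + ?t 2"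
    using sum.remove[OF fin y, of "\<lambda>x. ?t (real (deg A x))"] by simp
  also have "\<dots> = drop_bound (?d + 1)"
    by (simp add: drop_bound_def add_ac)
  finally show ?thesis .
qed

text \<open>If all neighbours of \<open>u\<close> were leaves, the component of \<open>u\<close>
  would be a star and \<open>v\<close> would be adjacent to \<open>u\<close>.\<close>

lemma connected_neighbour_deg_ge2:
  assumes "finite A" "sym A" "(u, v) \<in> A\<^sup>*" "u \<noteq> v" "(u, v) \<notin> A"
  obtains y where "(u, y) \<in> A" "2 \<le> deg A y"
proof (rule ccontr)
  assume "\<not> thesis"
  then have leaf: "\<not> 2 \<le> deg A y" if "(u, y) \<in> A" for y
    using that \<open>\<And>y. (u, y) \<in> A \<Longrightarrow> 2 \<le> deg A y \<Longrightarrow> thesis\<close> by blast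
  have "w = u \<or> (u, w) \<in> A" if "(u, w) \<in> A\<^sup>*" for w
    using that
  proof induction
    case (step y z)
    then show ?case
      using leaf[of y] deg_ge2[OF assms(1), of y u z] assms(2) by (auto dest: symD)
  qed auto
  then show False using assms by auto
qed

text \<open>The weight of the new edge pays for twice the term \<open>1 / (a + b)\<close> of
  \<open>drop_bound_sum\<close>, where \<open>a\<close> and \<open>b\<close> are the new degrees;
  twice \<open>31 / 210\<close> is left.\<close>

lemma hsum_add_cycle_edge:
  assumes "finite A" "sym A" "irrefl A" "(u, v) \<notin> A" "u \<noteq> v" "(u, v) \<in> A\<^sup>*"
  shows "hsum (add_edge u v A) \<ge> hsum A - 31 / 105"
proof -
  have vu: "(v, u) \<notin> A" "(v, u) \<in> A\<^sup>*"
    using assms(2,4,6) by (auto dest: symD intro: symD[OF sym_rtrancl])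
  obtain y where y: "(u, y) \<in> A" "2 \<le> deg A y"
    using connected_neighbour_deg_ge2[OF assms(1,2,6,5,4)] by blast
  obtain z where z: "(v, z) \<in> A" "2 \<le> deg A z"
    using connected_neighbour_deg_ge2[OF assms(1,2) vu(2)] vu assms(5) by blast
  have "1 \<le> deg A u" "1 \<le> deg A v" using deg_pos[OF assms(1)] y z by auto
  then have "drop_bound (deg A u + 1) + drop_bound (deg A v + 1) \<le> 31 / 210 + 1 / ((deg A u + 1) + (deg A v + 1))"
    using drop_bound_sum[of "deg A u + 1" "deg A v + 1"] by (simp add: add_ac)
  then show ?thesis
    using hsum_add_edge[OF assms(1-5)] neighbour_sum_le_drop_bound[OF assms(1,2) y]
      neighbour_sum_le_drop_bound[OF assms(1,2) z]
    by (simp add: add_ac)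
qed

section \<open>Unicyclic graphs as functional graphs\<close>

lemma sym_relpow: "sym A \<Longrightarrow> (x, y) \<in> A ^^ i \<Longrightarrow> (y, x) \<in> A ^^ i"
proof (induction i arbitrary: y)
  case (Suc i)
  then obtain z where "(x, z) \<in> A ^^ i" "(z, y) \<in> A" by auto
  then show ?case using Suc.IH Suc.prems(1) relpow_Suc_I2 symD by metis
qed simp

text \<open>Off the root, \<open>f\<close> is the parent map of a tree and \<open>d\<close> the
  depth. The edge from \<open>a\<close> to \<open>f a\<close> closes the cycle; depth at least 2
  keeps it from being a loop or a tree edge.\<close>

locale functional_graph =
  fixes V :: "'a set" and f :: "'a \<Rightarrow> 'a" and a :: 'a and d :: "'a \<Rightarrow> nat"
  assumes finite_V: "finite V"
    and root_in_V: "a \<in> V"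
    and f_in_V: "v \<in> V \<Longrightarrow> f v \<in> V"
    and d_root: "d a = 0"
    and d_step: "v \<in> V \<Longrightarrow> v \<noteq> a \<Longrightarrow> d v = Suc (d (f v))"
    and d_f_root: "2 \<le> d (f a)"
begin

definition girth :: nat where "girth = Suc (d (f a))"

definition cyc :: "'a set" where "cyc = (\<lambda>i. (f ^^ i) a) ` {..<girth}"

definition orbit :: "'a \<Rightarrow> 'a set" where "orbit x = range (\<lambda>i. (f ^^ i) x)"

text \<open>Each vertex stands for the edge to its image, so a vertex set alone encodes a
  subgraph.\<close>

definition arcs_of :: "'a set \<Rightarrow> ('a \<times> 'a) set" where
  "arcs_of S = (\<lambda>v. (v, f v)) ` S \<union> (\<lambda>v. (f v, v)) ` S"

text \<open>Such a set spans a connected unicyclic subgraph: its vertices flow into the cycle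
  without leaving it.\<close>

definition closed_set :: "'a set \<Rightarrow> bool" where
  "closed_set S \<longleftrightarrow> S \<subseteq> V \<and> cyc \<subseteq> S \<and> f ` S \<subseteq> S"

definition height :: "'a \<Rightarrow> nat" where "height x = (LEAST i. (f ^^ i) x \<in> cyc)"

definition base :: "'a \<Rightarrow> 'a" where "base x = (f ^^ height x) x"

section \<open>The cycle of a functional graph\<close>

lemma girth_ge3: "3 \<le> girth"
  using d_f_root by (simp add: girth_def)

lemma iter_iter: "(f ^^ i) ((f ^^ j) x) = (f ^^ (i + j)) x"
  by (simp add: funpow_add)

lemma iter_in_V: "x \<in> V \<Longrightarrow> (f ^^ i) x \<in> V"
  by (induction i) (auto intro: f_in_V)

lemma d_iter: "x \<in> V \<Longrightarrow> i \<le> d x \<Longrightarrow> d ((f ^^ i) x) = d x - i"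
proof (induction i)
  case (Suc i)
  then have "(f ^^ i) x \<noteq> a" using d_root by auto
  then show ?case using d_step[of "(f ^^ i) x"] iter_in_V Suc by auto
qed simp

lemma iter_d: "x \<in> V \<Longrightarrow> (f ^^ d x) x = a"
  using d_iter[of x "d x"] d_step[of "(f ^^ d x) x"] iter_in_V[of x "d x"] by auto

lemma iter_girth_root: "(f ^^ girth) a = a"
  using iter_d[OF f_in_V[OF root_in_V]] by (simp add: girth_def funpow_swap1)

lemma f_neq: "v \<in> V \<Longrightarrow> f v \<noteq> v"
  using d_step[of v] d_root d_f_root by (metis n_not_Suc_n not_numeral_le_zero)

lemma f_f_neq:
  assumes v: "v \<in> V"
  shows "f (f v) \<noteq> v"
proof
  assume eq: "f (f v) = v"
  show False
  proof (cases "v = a \<or> f v = a")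
    case True
    then have "f (f a) = a" using eq by auto
    then show False
      using d_step[OF f_in_V[OF root_in_V]] f_neq[OF root_in_V] d_root d_f_root by simp
  next
    case False
    then have "d v = Suc (d (f v))" "d (f v) = Suc (d v)"
      using d_step[OF v] d_step[OF f_in_V[OF v]] by (simp_all only: eq not_False_eq_True de_Morgan_disj)
    then show False by linarith
  qed
qed

text \<open>The depth separates the iterates: it is 0 at the root, jumps to
  \<open>girth - 1\<close>, and then falls by 1 at each step.\<close>

lemma inj_on_iter_root: "inj_on (\<lambda>i. (f ^^ i) a) {..<girth}"
proof -
  have d: "d ((f ^^ i) a) = (if i = 0 then 0 else girth - i)" if "i < girth" for i
  proof (cases i)
    case (Suc j)
    then show ?thesis
      using d_iter[OF f_in_V[OF root_in_V], of j] that
      by (simp add: girth_def funpow_swap1)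
  qed (simp add: d_root)
  show ?thesis
  proof (rule inj_onI)
    fix i j assume "i \<in> {..<girth}" "j \<in> {..<girth}" and eq: "(f ^^ i) a = (f ^^ j) a"
    then show "i = j"
      using d[of i] d[of j] by (simp split: if_splits)
  qed
qed

lemma card_cyc: "card cyc = girth"
  unfolding cyc_def by (simp add: card_image inj_on_iter_root)

lemma finite_cyc: "finite cyc"
  unfolding cyc_def by simp

lemma iter_root_in_cyc: "(f ^^ i) a \<in> cyc"
proof -
  have "(f ^^ i) a = (f ^^ (i mod girth)) a"
    by (rule funpow_mod_eq[OF iter_girth_root, symmetric])
  then show ?thesis using girth_ge3 unfolding cyc_def by auto
qed

lemma cyc_iter: "c \<in> cyc \<Longrightarrow> (f ^^ i) c \<in> cyc"
  using iter_root_in_cyc by (auto simp: cyc_def iter_iter)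

lemma cyc_f: "c \<in> cyc \<Longrightarrow> f c \<in> cyc"
  using cyc_iter[of c 1] by simp

lemma cyc_subset: "cyc \<subseteq> V"
  using iter_in_V[OF root_in_V] unfolding cyc_def by auto

lemma iter_girth: "c \<in> cyc \<Longrightarrow> (f ^^ girth) c = c"
  using iter_girth_root by (auto simp: cyc_def) (metis add.commute iter_iter)

text \<open>The two ways round the cycle between \<open>c\<close> and \<open>x\<close>, of lengths
  \<open>i\<close> and \<open>girth - i\<close>.\<close>

lemma cyc_reach:
  assumes "c \<in> cyc" "x \<in> cyc"
  obtains i where "i < girth" "(f ^^ i) c = x" "(f ^^ (girth - i)) x = c"
proof -
  obtain p where p: "p < girth" "c = (f ^^ p) a" using assms(1) by (auto simp: cyc_def)
  obtain q where q: "q < girth" "x = (f ^^ q) a" using assms(2) by (auto simp: cyc_def)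
  define i where "i = (if p \<le> q then q - p else girth - p + q)"
  have i: "i < girth" using p q by (auto simp: i_def)
  have x: "(f ^^ i) c = x"
  proof (cases "p \<le> q")
    case True
    then have "i + p = q" by (simp add: i_def)
    then show ?thesis using p(2) q(2) by (simp add: iter_iter)
  next
    case False
    then have "i + p = q + girth" using p by (simp add: i_def)
    then have "(f ^^ i) c = (f ^^ q) ((f ^^ girth) a)" using p(2) by (simp add: iter_iter)
    then show ?thesis using q(2) iter_girth_root by simp
  qed
  have "(f ^^ (girth - i)) ((f ^^ i) c) = (f ^^ girth) c"
    using i by (simp add: iter_iter)
  then have "(f ^^ (girth - i)) x = c" unfolding x iter_girth[OF assms(1)] .
  with i x show thesis by (rule that)
qed

text \<open>The predecessor is the iterate of \<open>y\<close> by \<open>girth - 1\<close>. It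
  differs from the successor because \<open>f\<close> has no 2-cycle, so \<open>y\<close> has two
  neighbours on the cycle.\<close>

lemma cyc_preimage:
  assumes "y \<in> cyc"
  obtains z where "z \<in> cyc" "{x \<in> cyc. f x = y} = {z}" "z \<noteq> f y"
proof -
  obtain k where k: "girth = Suc k" by (simp add: girth_def)
  define z where "z = (f ^^ k) y"
  have z: "z \<in> cyc" "f z = y"
    using cyc_iter[OF assms] iter_girth[OF assms] k by (auto simp: z_def)
  have "x = z" if "x \<in> cyc" "f x = y" for x
    using iter_girth[OF that(1)] that(2) k by (metis comp_apply funpow_Suc_right z_def)
  then have "{x \<in> cyc. f x = y} = {z}" using z by blast
  moreover have "z \<noteq> f y" using f_f_neq[of z] z cyc_subset by (metis subsetD)
  ultimately show thesis using that z by blast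
qed

section \<open>Closed vertex sets and the growth of the Harmonic index under new leaves\<close>

lemma finite_arcs_of: "finite S \<Longrightarrow> finite (arcs_of S)"
  by (simp add: arcs_of_def)

lemma sym_arcs_of: "sym (arcs_of S)"
  by (auto simp: arcs_of_def sym_def)

lemma irrefl_arcs_of: "S \<subseteq> V \<Longrightarrow> irrefl (arcs_of S)"
  using f_neq by (fastforce simp: arcs_of_def irrefl_def)

lemma arcs_of_Image: "arcs_of S `` {y} = (if y \<in> S then {f y} else {}) \<union> {z \<in> S. f z = y}"
  by (auto simp: arcs_of_def)

lemma arcs_of_insert: "arcs_of (insert v S) = add_edge (f v) v (arcs_of S)"
  by (auto simp: arcs_of_def add_edge_def)

lemma closed_set_finite: "closed_set S \<Longrightarrow> finite S"
  using finite_V finite_subset by (auto simp: closed_set_def)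

lemma closed_set_arcs:
  assumes "closed_set S"
  shows "finite (arcs_of S)" "sym (arcs_of S)" "irrefl (arcs_of S)"
  using assms closed_set_finite finite_arcs_of sym_arcs_of irrefl_arcs_of
  by (auto simp: closed_set_def)

lemma closed_set_insert:
  "closed_set S \<Longrightarrow> v \<in> V \<Longrightarrow> f v \<in> S \<Longrightarrow> closed_set (insert v S)"
  by (auto simp: closed_set_def)

lemma closed_set_cyc: "closed_set cyc"
  using cyc_subset cyc_f by (auto simp: closed_set_def)

lemma closed_set_Un_orbit: "closed_set S \<Longrightarrow> x \<in> V \<Longrightarrow> closed_set (S \<union> orbit x)"
proof -
  assume "closed_set S" "x \<in> V"
  moreover have "f ` orbit x \<subseteq> orbit x"
    unfolding orbit_def using rangeI[of "\<lambda>i. (f ^^ i) x" "Suc _"] by auto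
  ultimately show ?thesis using iter_in_V by (auto simp: closed_set_def orbit_def)
qed

lemma orbit_subset: "f ` S \<subseteq> S \<Longrightarrow> x \<in> S \<Longrightarrow> orbit x \<subseteq> S"
proof -
  assume "f ` S \<subseteq> S" "x \<in> S"
  then have "(f ^^ i) x \<in> S" for i by (induction i) auto
  then show ?thesis by (auto simp: orbit_def)
qed

text \<open>As \<open>f\<close> maps \<open>S\<close> into itself, nothing in \<open>S\<close> is
  sent to \<open>v\<close>; so \<open>v\<close> is isolated before and a leaf afterwards.\<close>

lemma hsum_insert_ge:
  assumes "closed_set S" "v \<in> V" "v \<notin> S" "f v \<in> S"
    and k: "\<And>x. (f v, x) \<in> arcs_of S \<Longrightarrow> k \<le> deg (arcs_of S) x"
  defines "e \<equiv> real (deg (arcs_of S) (f v))"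
  shows "hsum (arcs_of (insert v S)) \<ge> hsum (arcs_of S)
    + 2 / (e + 2) - 2 * e / ((e + real k) * (e + real k + 1))" and "1 \<le> e"
proof -
  have "arcs_of S `` {v} = {}"
    using assms by (auto simp: arcs_of_Image closed_set_def)
  moreover have "(f v, f (f v)) \<in> arcs_of S" using assms(4) by (auto simp: arcs_of_def)
  then have e: "1 \<le> deg (arcs_of S) (f v)" using deg_pos closed_set_arcs(1)[OF assms(1)] by fast
  ultimately show "hsum (arcs_of (insert v S)) \<ge> hsum (arcs_of S)
    + 2 / (e + 2) - 2 * e / ((e + real k) * (e + real k + 1))"
    using hsum_add_leaf_ge[OF closed_set_arcs[OF assms(1)], of v "f v" k] k f_neq[OF assms(2)]
    unfolding e_def arcs_of_insert by simp
  show "1 \<le> e" using e by (simp add: e_def)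
qed

lemma hsum_insert_mono:
  assumes "closed_set S" "v \<in> V" "v \<notin> S" "f v \<in> S"
  shows "hsum (arcs_of S) \<le> hsum (arcs_of (insert v S))"
proof -
  let ?e = "real (deg (arcs_of S) (f v))"
  have "1 \<le> deg (arcs_of S) x" if "(f v, x) \<in> arcs_of S" for x
    using deg_pos[OF closed_set_arcs(1)[OF assms(1)]] symD[OF sym_arcs_of that] by fast
  from hsum_insert_ge[OF assms, OF this]
  have 1: "hsum (arcs_of (insert v S)) \<ge> hsum (arcs_of S)
    + 2 / (?e + 2) - 2 * ?e / ((?e + 1) * (?e + 1 + 1))" and e: "1 \<le> ?e" by auto
  have "2 * ?e / ((?e + 1) * (?e + 1 + 1)) \<le> 2 / (?e + 2)"
  proof -
    have "?e / (?e + 1) * (2 / (?e + 2)) \<le> 2 / (?e + 2)"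
      using e by (intro mult_left_le_one_le) auto
    then show ?thesis by (simp add: add_ac mult_ac)
  qed
  with 1 show ?thesis by linarith
qed

text \<open>Here \<open>f v\<close> is a leaf of \<open>S\<close> whose neighbour has degree at
  least 2, so the gain is at least \<open>2/3 - 2/(3 * 4) = 1/2\<close>.\<close>

lemma hsum_insert_path:
  assumes "closed_set S" "v \<in> V" "v \<notin> S" "f v \<in> S" "\<And>z. z \<in> S \<Longrightarrow> f z \<noteq> f v"
  shows "hsum (arcs_of S) + 1 / 2 \<le> hsum (arcs_of (insert v S))"
proof -
  have N: "arcs_of S `` {f v} = {f (f v)}" using assms(4,5) by (auto simp: arcs_of_Image)
  have "f v \<in> S" "f (f v) \<in> S" using assms by (auto simp: closed_set_def)
  then have "2 \<le> deg (arcs_of S) (f (f v))"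
    using assms(5)[of "f (f v)"] closed_set_arcs(1)[OF assms(1)]
    by (intro deg_ge2[of _ _ "f v" "f (f (f v))"]) (auto simp: arcs_of_def)
  then have "2 \<le> deg (arcs_of S) x" if "(f v, x) \<in> arcs_of S" for x
    using N that by (metis Image_singleton_iff singletonD)
  from hsum_insert_ge(1)[OF assms(1-4), OF this]
  show ?thesis using N by (simp add: deg_def)
qed

lemma deg_cyc_ge2:
  assumes "closed_set S" "y \<in> cyc"
  shows "2 \<le> deg (arcs_of S) y"
proof -
  obtain z where z: "z \<in> cyc" "{x \<in> cyc. f x = y} = {z}" "z \<noteq> f y"
    using cyc_preimage[OF assms(2)] .
  then have "f z = y" by auto
  then show ?thesis
    using z assms closed_set_arcs(1)[OF assms(1)]
    by (intro deg_ge2[of _ _ z "f y"]) (auto simp: arcs_of_def closed_set_def)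
qed

lemma deg_cyc_eq2:
  assumes "closed_set S" "y \<in> cyc" "\<And>z. z \<in> S \<Longrightarrow> f z = y \<Longrightarrow> z \<in> cyc"
  obtains z where "z \<in> cyc" "arcs_of S `` {y} = {f y, z}" "deg (arcs_of S) y = 2"
proof -
  obtain z where z: "z \<in> cyc" "{x \<in> cyc. f x = y} = {z}" "z \<noteq> f y"
    using cyc_preimage[OF assms(2)] .
  have "{x \<in> S. f x = y} = {z}" using z assms by (auto simp: closed_set_def)
  then have "arcs_of S `` {y} = {f y, z}" using assms by (auto simp: arcs_of_Image closed_set_def)
  then show thesis using that z by (auto simp: deg_def)
qed

text \<open>Here \<open>f v\<close> still has degree 2 and both neighbours lie on the cycle, so the
  gain is at least \<open>2/4 - 4/(4 * 5) = 3/10\<close>.\<close>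

lemma hsum_insert_cyc:
  assumes "closed_set S" "v \<in> V" "v \<notin> S" "f v \<in> cyc" "\<And>z. z \<in> S \<Longrightarrow> f z = f v \<Longrightarrow> z \<in> cyc"
  shows "hsum (arcs_of S) + 3 / 10 \<le> hsum (arcs_of (insert v S))"
proof -
  obtain z where z: "z \<in> cyc" "arcs_of S `` {f v} = {f (f v), z}" "deg (arcs_of S) (f v) = 2"
    using deg_cyc_eq2[OF assms(1,4,5)] by blast
  then have "2 \<le> deg (arcs_of S) x" if "(f v, x) \<in> arcs_of S" for x
    using deg_cyc_ge2[OF assms(1)] cyc_f[OF assms(4)] that
    by (metis Image_singleton_iff insertE singletonD)
  moreover have "f v \<in> S" using assms by (auto simp: closed_set_def)
  ultimately show ?thesis using hsum_insert_ge(1)[OF assms(1-3), of 2] z by simp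
qed

lemma hsum_cyc: "hsum (arcs_of cyc) = girth / 2"
proof -
  have deg: "deg (arcs_of cyc) y = 2" if "y \<in> cyc" for y
    using deg_cyc_eq2[OF closed_set_cyc that] by blast
  have sub: "arcs_of cyc \<subseteq> cyc \<times> cyc" using cyc_f by (auto simp: arcs_of_def)
  have "arcs_of cyc = (SIGMA y:cyc. arcs_of cyc `` {y})" using sub by auto
  then have "card (arcs_of cyc) = card (SIGMA y:cyc. arcs_of cyc `` {y})"
    by (rule arg_cong)
  also have "\<dots> = (\<Sum>y\<in>cyc. card (arcs_of cyc `` {y}))"
    using finite_cyc finite_Image_singleton[OF finite_arcs_of[OF finite_cyc]]
    by (intro card_SigmaI) auto
  also have "\<dots> = 2 * girth" using deg by (simp add: deg_def card_cyc)
  finally have card: "card (arcs_of cyc) = 2 * girth" .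
  have "hsum (arcs_of cyc) = (\<Sum>p\<in>arcs_of cyc. 1 / 4)"
    unfolding hsum_def by (rule sum.cong) (use sub deg in auto)
  then show ?thesis using card by simp
qed

text \<open>Add the missing vertices by increasing depth: the image of a shallowest missing vertex
  is already present.\<close>

lemma hsum_closed_le: "closed_set S \<Longrightarrow> hsum (arcs_of S) \<le> hsum (arcs_of V)"
proof (induction "card (V - S)" arbitrary: S)
  case 0
  then have "S = V" using finite_V by (auto simp: closed_set_def)
  then show ?case by simp
next
  case (Suc n)
  then have "V - S \<noteq> {}" by (metis card.empty nat.distinct(1))
  then obtain v where v: "v \<in> V - S" "\<And>w. w \<in> V - S \<Longrightarrow> d v \<le> d w"
    using arg_min_nat_lemma[of "\<lambda>v. v \<in> V - S" _ d] by blast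
  have "a \<in> S" using Suc(3) iter_root_in_cyc[of 0] by (auto simp: closed_set_def)
  then have "v \<noteq> a" using v by auto
  then have "d (f v) < d v" using v d_step[of v] by auto
  then have fv: "f v \<in> S" using v f_in_V[of v] by (metis DiffD1 DiffI not_less)
  have "n = card (V - insert v S)"
    using Suc(2) v finite_V
    by (metis Diff_insert card_Diff_singleton diff_Suc_1)
  then have "hsum (arcs_of (insert v S)) \<le> hsum (arcs_of V)"
    using Suc(1) closed_set_insert[OF Suc(3) _ fv] v by auto
  then show ?case using hsum_insert_mono[OF Suc(3) _ _ fv] v by fastforce
qed

text \<open>The path is attached at a leaf of \<open>S\<close> and built outwards from there, each
  of its \<open>m\<close> vertices prolonging a pendant path.\<close>

lemma hsum_extend_path:
  assumes "closed_set S" "x \<in> V" "(f ^^ m) x \<in> S" "\<And>i. i < m \<Longrightarrow> (f ^^ i) x \<notin> S"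
    "\<And>z. z \<in> S \<Longrightarrow> f z \<noteq> (f ^^ m) x"
  shows "hsum (arcs_of S) + m / 2 \<le> hsum (arcs_of (S \<union> orbit x))"
  using assms
proof (induction m arbitrary: S)
  case 0
  then have "S \<union> orbit x = S" using orbit_subset[of S x] by (auto simp: closed_set_def)
  then show ?case by simp
next
  case (Suc m)
  let ?v = "(f ^^ m) x"
  let ?S = "insert ?v S"
  have v: "?v \<in> V" "?v \<notin> S" "f ?v \<in> S" using Suc.prems iter_in_V by auto
  have S: "closed_set ?S" using closed_set_insert Suc.prems v by blast
  \<comment> \<open>An earlier occurrence of \<open>?v\<close> at step \<open>i < m\<close> would
    bring the orbit into \<open>S\<close> at step \<open>i + 1\<close>, too early.\<close>
  have new: "(f ^^ i) x \<noteq> ?v" if "i < m" for i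
  proof
    assume "(f ^^ i) x = ?v"
    then have "(f ^^ Suc i) x \<in> S" using v(3) by simp
    then show False using Suc.prems(4)[of "Suc i"] that by simp
  qed
  have "hsum (arcs_of S) + 1 / 2 \<le> hsum (arcs_of ?S)"
    using hsum_insert_path[OF Suc.prems(1) v] Suc.prems(5) by simp
  moreover have "hsum (arcs_of ?S) + m / 2 \<le> hsum (arcs_of (?S \<union> orbit x))"
  proof (rule Suc.IH[OF S])
    fix z assume "z \<in> ?S"
    then show "f z \<noteq> ?v"
      using v Suc.prems(1) by (auto simp: closed_set_def)
  qed (use Suc.prems new in auto)
  moreover have "?S \<union> orbit x = S \<union> orbit x" by (auto simp: orbit_def)
  ultimately show ?case by (simp add: field_simps)
qed

text \<open>The vertex next to \<open>S\<close> is split off because its gain depends on the place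
  of attachment; the remaining \<open>m\<close> vertices gain \<open>1/2\<close> each.\<close>

lemma hsum_extend_first:
  assumes "closed_set S" "x \<in> V" "(f ^^ Suc m) x \<in> S" "\<And>i. i < Suc m \<Longrightarrow> (f ^^ i) x \<notin> S"
  defines "v \<equiv> (f ^^ m) x"
  shows "hsum (arcs_of (insert v S)) + m / 2 \<le> hsum (arcs_of (S \<union> orbit x))"
proof -
  have v: "v \<in> V" "v \<notin> S" "f v \<in> S" using assms iter_in_V by (auto simp: v_def)
  have new: "(f ^^ i) x \<noteq> v" if "i < m" for i
  proof
    assume "(f ^^ i) x = v"
    then have "(f ^^ Suc i) x \<in> S" using v(3) by simp
    then show False using assms(4)[of "Suc i"] that by simp
  qed
  have "hsum (arcs_of (insert v S)) + m / 2 \<le> hsum (arcs_of (insert v S \<union> orbit x))"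
  proof (rule hsum_extend_path)
    show "closed_set (insert v S)" using closed_set_insert assms v by blast
    fix z assume "z \<in> insert v S"
    then show "f z \<noteq> (f ^^ m) x"
      using v assms(1) by (auto simp: closed_set_def v_def)
  qed (use assms new in \<open>auto simp: v_def\<close>)
  moreover have "insert v S \<union> orbit x = S \<union> orbit x" by (auto simp: orbit_def v_def)
  ultimately show ?thesis by simp
qed

text \<open>Attachment may be anywhere in \<open>S\<close>, so the first vertex is only credited
  with gain 0.\<close>

lemma hsum_Un_orbit_ge:
  assumes "closed_set S" "x \<in> V" "(f ^^ m) x \<in> S" "\<And>i. i < m \<Longrightarrow> (f ^^ i) x \<notin> S"
  shows "hsum (arcs_of S) + (real m - 1) / 2 \<le> hsum (arcs_of (S \<union> orbit x))"
proof (cases m)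
  case 0
  then have "S \<union> orbit x = S" using orbit_subset[of S x] assms by (auto simp: closed_set_def)
  then show ?thesis using 0 by simp
next
  case (Suc n)
  have "hsum (arcs_of S) \<le> hsum (arcs_of (insert ((f ^^ n) x) S))"
    using hsum_insert_mono[OF assms(1) iter_in_V[OF assms(2)], of n] assms Suc by auto
  then show ?thesis using hsum_extend_first[of S x n] assms Suc by auto
qed

text \<open>At a cycle vertex without branches the first vertex gains \<open>3/10\<close>, and
  \<open>3/10 + (m - 1)/2 = m/2 - 1/5\<close>.\<close>

lemma hsum_Un_orbit_cyc_ge:
  assumes "closed_set S" "x \<in> V" "(f ^^ m) x \<in> cyc" "\<And>i. i < m \<Longrightarrow> (f ^^ i) x \<notin> S"
    "\<And>z. z \<in> S \<Longrightarrow> f z = (f ^^ m) x \<Longrightarrow> z \<in> cyc"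
  shows "hsum (arcs_of S) + (m / 2 - 1 / 5) \<le> hsum (arcs_of (S \<union> orbit x))"
proof (cases m)
  case 0
  then have "S \<union> orbit x = S" using orbit_subset[of S x] assms by (auto simp: closed_set_def)
  then show ?thesis using 0 by simp
next
  case (Suc n)
  have "hsum (arcs_of S) + 3 / 10 \<le> hsum (arcs_of (insert ((f ^^ n) x) S))"
    using hsum_insert_cyc[OF assms(1) iter_in_V[OF assms(2)], of n] assms Suc by auto
  moreover have "(f ^^ m) x \<in> S" using assms by (auto simp: closed_set_def)
  ultimately show ?thesis
    using hsum_extend_first[of S x n] assms Suc by (auto simp: field_simps)
qed


section \<open>Pendant paths at distinct cycle vertices\<close>

lemma iter_height: "x \<in> V \<Longrightarrow> (f ^^ height x) x \<in> cyc"
  unfolding height_def by (rule LeastI[of _ "d x"]) (use iter_d iter_root_in_cyc[of 0] in auto)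

lemma iter_less_height: "i < height x \<Longrightarrow> (f ^^ i) x \<notin> cyc"
  unfolding height_def by (rule not_less_Least)

lemma height_eqI: "(f ^^ m) x \<in> cyc \<Longrightarrow> (\<And>i. i < m \<Longrightarrow> (f ^^ i) x \<notin> cyc) \<Longrightarrow> height x = m"
  unfolding height_def by (rule Least_equality) (auto simp: not_less[symmetric])

lemma height_iter: "x \<in> V \<Longrightarrow> i \<le> height x \<Longrightarrow> height ((f ^^ i) x) = height x - i"
proof (rule height_eqI)
  assume x: "x \<in> V" "i \<le> height x"
  show "(f ^^ (height x - i)) ((f ^^ i) x) \<in> cyc" using iter_height x by (simp add: iter_iter)
  show "(f ^^ j) ((f ^^ i) x) \<notin> cyc" if "j < height x - i" for j
    using that by (simp add: iter_iter iter_less_height)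
qed

lemma base_iter: "x \<in> V \<Longrightarrow> i \<le> height x \<Longrightarrow> base ((f ^^ i) x) = base x"
  unfolding base_def by (simp add: height_iter iter_iter)

lemma base_in_cyc: "x \<in> V \<Longrightarrow> base x \<in> cyc"
  unfolding base_def by (rule iter_height)

lemma iter_notin_cyc: "x \<in> V \<Longrightarrow> (f ^^ i) x \<notin> cyc \<Longrightarrow> i < height x"
proof (rule ccontr)
  assume "x \<in> V" "(f ^^ i) x \<notin> cyc" "\<not> i < height x"
  then show False
    using cyc_iter[OF iter_height, of x "i - height x"]
    by (simp add: iter_iter)
qed

text \<open>Distinct feet make each new path meet the earlier ones only on the cycle, and its foot
  carries no branch yet.\<close>

lemma hsum_orbits_ge:
  assumes "finite I" "I \<subseteq> V" "inj_on base I"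
  shows "closed_set (cyc \<union> \<Union> (orbit ` I)) \<and>
    girth / 2 + (\<Sum>x\<in>I. height x / 2 - 1 / 5) \<le> hsum (arcs_of (cyc \<union> \<Union> (orbit ` I)))"
  using assms
proof (induction I rule: finite_induct)
  case empty
  then show ?case by (simp add: closed_set_cyc hsum_cyc)
next
  case (insert x I)
  let ?S = "cyc \<union> \<Union> (orbit ` I)"
  have x: "x \<in> V" and I: "I \<subseteq> V" using insert.prems by auto
  have S: "closed_set ?S" "girth / 2 + (\<Sum>x\<in>I. height x / 2 - 1 / 5) \<le> hsum (arcs_of ?S)"
    using insert by auto
  have other: "base z \<noteq> base x" if z: "z \<in> ?S" "z \<notin> cyc" for z
  proof -
    obtain y j where y: "y \<in> I" "z = (f ^^ j) y" using z by (auto simp: orbit_def)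
    then have "base z = base y" using base_iter[of y j] iter_notin_cyc[of y j] z I by auto
    then show ?thesis using y insert by (auto simp: inj_on_def)
  qed
  have ge: "hsum (arcs_of ?S) + (height x / 2 - 1 / 5) \<le> hsum (arcs_of (?S \<union> orbit x))"
  proof (rule hsum_Un_orbit_cyc_ge[OF S(1) x iter_height[OF x]])
    fix i assume i: "i < height x"
    then have "(f ^^ i) x \<notin> cyc" "base ((f ^^ i) x) = base x"
      using iter_less_height base_iter x by auto
    then show "(f ^^ i) x \<notin> ?S" using other by blast
  next
    fix z assume z: "z \<in> ?S" "f z = (f ^^ height x) x"
    show "z \<in> cyc"
    proof (rule ccontr)
      assume n: "z \<notin> cyc"
      have "height z = 1"
        using height_eqI[of 1 z] n z(2) iter_height[OF x] by auto
      then have "base z = base x" using z(2) by (simp add: base_def)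
      then show False using other z(1) n by blast
    qed
  qed
  have eq: "cyc \<union> \<Union> (orbit ` insert x I) = ?S \<union> orbit x" by auto
  show ?case
    unfolding eq sum.insert[OF insert.hyps]
    using S(2) ge closed_set_Un_orbit[OF S(1) x] by linarith
qed

lemma hsum_ge_orbits:
  assumes "finite I" "I \<subseteq> V" "inj_on base I"
  shows "girth / 2 + (\<Sum>x\<in>I. height x / 2 - 1 / 5) \<le> hsum (arcs_of V)"
  using order.trans[OF conjunct2 hsum_closed_le[OF conjunct1]] hsum_orbits_ge[OF assms]
  by blast

section \<open>Walks and the comparison with the radius\<close>

lemma walk_iter: "x \<in> V \<Longrightarrow> (x, (f ^^ i) x) \<in> arcs_of V ^^ i"
proof (induction i)
  case (Suc i)
  then have "((f ^^ i) x, (f ^^ Suc i) x) \<in> arcs_of V" using iter_in_V by (auto simp: arcs_of_def)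
  then show ?case by (rule relpow_Suc_I[OF Suc.IH[OF Suc.prems]])
qed simp

lemma walk_base: "x \<in> V \<Longrightarrow> (x, base x) \<in> arcs_of V ^^ height x"
  unfolding base_def by (rule walk_iter)

lemma walk_trans:
  "(x, y) \<in> arcs_of V ^^ i \<Longrightarrow> (y, z) \<in> arcs_of V ^^ j \<Longrightarrow> (x, z) \<in> arcs_of V ^^ (i + j)"
  by (auto simp: relpow_add)

lemma walk_meet:
  assumes "x \<in> V" "y \<in> V" "(f ^^ i) x = (f ^^ j) y"
  shows "(x, y) \<in> arcs_of V ^^ (i + j)"
  using walk_trans[OF walk_iter[OF assms(1), of i]] sym_relpow[OF sym_arcs_of walk_iter[OF assms(2), of j]] assms(3)
  by metis

text \<open>Take the shorter way round. The last clause identifies the antipode in the extremal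
  case.\<close>

lemma walk_cyc:
  assumes "c \<in> cyc" "x \<in> cyc"
  obtains k where "(c, x) \<in> arcs_of V ^^ k" "2 * k \<le> girth" "2 * k = girth \<Longrightarrow> x = (f ^^ k) c"
proof -
  obtain i where i: "i < girth" "(f ^^ i) c = x" "(f ^^ (girth - i)) x = c"
    using cyc_reach[OF assms] .
  have V: "c \<in> V" "x \<in> V" using assms cyc_subset by auto
  show thesis
  proof (cases "2 * i \<le> girth")
    case True
    then show ?thesis using that[of i] walk_iter[OF V(1), of i] i by auto
  next
    case False
    then show ?thesis using that[of "girth - i"] sym_relpow[OF sym_arcs_of walk_iter[OF V(2), of "girth - i"]] i by auto
  qed
qed

text \<open>\<open>far\<close> expresses through walks that every eccentricity is at least
  \<open>R\<close>.\<close>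

lemma hsum_ge_radius:
  assumes far: "\<And>u. u \<in> V \<Longrightarrow> \<exists>w\<in>V. \<forall>n. (u, w) \<in> arcs_of V ^^ n \<longrightarrow> R \<le> n"
  shows "real R \<le> hsum (arcs_of V)"
proof (cases "R = 0")
  case True
  then show ?thesis using hsum_nonneg by simp
next
  case False
  have fin: "finite (height ` V)" "height ` V \<noteq> {}" using finite_V root_in_V by auto
  obtain x where x: "x \<in> V" "height x = Max (height ` V)"
    using Max_in[OF fin] by auto
  have max: "height w \<le> height x" if "w \<in> V" for w
    using x Max_ge[OF fin(1)] that by auto
  \<comment> \<open>The total loss \<open>2/5\<close> is below \<open>1/2\<close>, so
    \<open>girth + height x + height w\<close> at least \<open>2 * R + 1\<close> suffices.\<close>
  have pair: "real girth / 2 + height x / 2 + height w / 2 - 2 / 5 \<le> hsum (arcs_of V)"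
    if "w \<in> V" "base w \<noteq> base x" for w
  proof -
    have "w \<noteq> x" using that by auto
    then show ?thesis using hsum_ge_orbits[of "{x, w}"] that x by auto
  qed
  show ?thesis
  proof (cases "R \<le> height x + 1")
    case True
    define t where "t = R - 1"
    have t: "t \<le> height x" "R = t + 1" using True False by (auto simp: t_def)
    \<comment> \<open>With \<open>t = R - 1\<close>, the vertex \<open>x\<close> itself is too close
      to \<open>u\<close> to serve as \<open>w\<close>.\<close>
    define u where "u = (f ^^ t) x"
    have u: "u \<in> V" "height u = height x - t" "base u = base x"
      using x t iter_in_V height_iter base_iter by (auto simp: u_def)
    obtain w where w: "w \<in> V" "\<And>n. (u, w) \<in> arcs_of V ^^ n \<Longrightarrow> R \<le> n"
      using far[OF u(1)] by blast
    show ?thesis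
    proof (cases "base w = base x")
      case False
      obtain k where k: "(base x, base w) \<in> arcs_of V ^^ k" "2 * k \<le> girth"
        using walk_cyc[of "base x" "base w"] base_in_cyc x w by metis
      have "(u, base x) \<in> arcs_of V ^^ (height x - t)"
        using walk_base[OF u(1)] u by simp
      moreover have "(base w, w) \<in> arcs_of V ^^ height w"
        by (rule sym_relpow[OF sym_arcs_of walk_base[OF w(1)]])
      ultimately have "R \<le> height x - t + k + height w"
        using w(2) walk_trans k(1) by blast
      \<comment> \<open>Insert \<open>t = R - 1\<close>; moreover \<open>k + 2\<close> is at most
        \<open>girth\<close>, as \<open>girth\<close> is at least 3 and at least
        \<open>2 * k\<close>.\<close>
      then have "2 * R + 1 \<le> girth + height x + height w"
        using k(2) t girth_ge3 by linarith
      then have "2 * real R + 1 \<le> real girth + height x + height w"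
        by (metis (mono_tags, lifting) of_nat_1 of_nat_add of_nat_le_iff of_nat_mult of_nat_numeral)
      then show ?thesis using pair[OF w(1) False] by simp
    next
      case same: True
      let ?S = "cyc \<union> orbit x"
      \<comment> \<open>The path of \<open>w\<close> joins the cycle or the path of \<open>x\<close>
        after \<open>m\<close> steps.\<close>
      define m where "m = (LEAST i. (f ^^ i) w \<in> ?S)"
      have Sm: "(f ^^ height w) w \<in> ?S" using iter_height[OF w(1)] by simp
      have m: "(f ^^ m) w \<in> ?S" "m \<le> height w" "\<And>i. i < m \<Longrightarrow> (f ^^ i) w \<notin> ?S"
        unfolding m_def using LeastI[of "\<lambda>i. (f ^^ i) w \<in> ?S", OF Sm]
          Least_le[of "\<lambda>i. (f ^^ i) w \<in> ?S", OF Sm] not_less_Least by blast+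
      obtain s where s: "s \<le> height x" "(f ^^ m) w = (f ^^ s) x"
      proof (cases "(f ^^ m) w \<in> cyc")
        case True
        then have "m = height w" using m(2) iter_less_height[of m w] by fastforce
        then show ?thesis using that[of "height x"] same by (simp add: base_def)
      next
        case False
        then obtain s where "(f ^^ m) w = (f ^^ s) x" using m(1) by (auto simp: orbit_def)
        then show ?thesis using that[of s] iter_notin_cyc[OF x(1), of s] False by auto
      qed
      have heights: "height w - m = height x - s"
        using height_iter[OF w(1) m(2)] height_iter[OF x(1) s(1)] s(2) by simp
      \<comment> \<open>If \<open>w\<close> branched off strictly above \<open>u\<close>, then
        \<open>m\<close> would be at most \<open>s\<close> by maximality of \<open>height x\<close>,
        and \<open>w\<close> would lie within \<open>t < R\<close> of \<open>u\<close>.\<close>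
      have "t \<le> s"
      proof (rule ccontr)
        assume "\<not> t \<le> s"
        then have "(f ^^ (t - s + m)) w = u"
          using iter_iter[of "t - s" m w] iter_iter[of "t - s" s x] s(2) by (simp add: u_def)
        then have "(u, w) \<in> arcs_of V ^^ (t - s + m)"
          using sym_relpow[OF sym_arcs_of walk_iter[OF w(1)]] by metis
        then have "R \<le> t - s + m" by (rule w(2))
        then show False using heights max[OF w(1)] m(2) s(1) t \<open>\<not> t \<le> s\<close> by linarith
      qed
      then have "(f ^^ (s - t)) u = (f ^^ m) w"
        using iter_iter[of "s - t" t x] s(2) by (simp add: u_def)
      then have "R \<le> s - t + m" using walk_meet[OF u(1) w(1)] w(2) by blast
      \<comment> \<open>The surplus 2 covers the losses, which after halving are \<open>1/5\<close>
        for \<open>x\<close> and \<open>1/2\<close> for \<open>w\<close>, against 1.\<close>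
      then have "2 * R + 2 \<le> girth + height x + m"
        using t s girth_ge3 \<open>t \<le> s\<close> by linarith
      then have R: "2 * real R + 2 \<le> real girth + height x + m"
        by (metis (mono_tags, lifting) of_nat_add of_nat_le_iff of_nat_mult of_nat_numeral)
      have S: "closed_set ?S" "girth / 2 + (height x / 2 - 1 / 5) \<le> hsum (arcs_of ?S)"
        using hsum_orbits_ge[of "{x}"] x by auto
      have "hsum (arcs_of ?S) + (real m - 1) / 2 \<le> hsum (arcs_of (?S \<union> orbit w))"
        using hsum_Un_orbit_ge[OF S(1) w(1)] m by blast
      also have "\<dots> \<le> hsum (arcs_of V)"
        using hsum_closed_le closed_set_Un_orbit S(1) w(1) by blast
      finally show ?thesis using S(2) R by (simp add: field_simps)
    qed
  next
    case big: False
    \<comment> \<open>Vertices with foot \<open>c\<close> are within \<open>height x < R\<close> of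
      \<open>c\<close>, so a far vertex has another foot.\<close>
    have step: "\<exists>w k. w \<in> V \<and> base w \<noteq> c \<and> R \<le> height w + k \<and> 2 * k \<le> girth
        \<and> (2 * k = girth \<longrightarrow> base w = (f ^^ k) c)" if c: "c \<in> cyc" for c
    proof -
      obtain w where w: "w \<in> V" "\<And>n. (c, w) \<in> arcs_of V ^^ n \<Longrightarrow> R \<le> n"
        using far[of c] c cyc_subset by blast
      obtain k where k: "(c, base w) \<in> arcs_of V ^^ k" "2 * k \<le> girth"
        "2 * k = girth \<Longrightarrow> base w = (f ^^ k) c"
        using walk_cyc[OF c base_in_cyc[OF w(1)]] by metis
      have bw: "(base w, w) \<in> arcs_of V ^^ height w"
        by (rule sym_relpow[OF sym_arcs_of walk_base[OF w(1)]])
      then have "base w \<noteq> c" using w(2) max[OF w(1)] big by fastforce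
      moreover have "R \<le> height w + k" using w(2) walk_trans[OF k(1) bw] by (simp add: add.commute)
      ultimately show ?thesis using w(1) k by blast
    qed
    obtain w k where w: "w \<in> V" "base w \<noteq> base x" "R \<le> height w + k" "2 * k \<le> girth"
      using step[OF base_in_cyc[OF x(1)]] by blast
    show ?thesis
    proof (cases "2 * R + 1 \<le> girth + height x + height w")
      case True
      then have "2 * real R + 1 \<le> real girth + height x + height w"
        by (metis (mono_tags, lifting) of_nat_1 of_nat_add of_nat_le_iff of_nat_mult of_nat_numeral)
      then show ?thesis using pair[OF w(1,2)] by simp
    next
      case False
      \<comment> \<open>Without the extra vertex all estimates are equalities: equal heights,
        antipodal feet, and \<open>R = h + q\<close>.\<close>
      define h where "h = height x"
      define q where "q = k"
      have eq: "height w = h" using False w(3,4) max[OF w(1)] unfolding h_def by linarith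
      then have q: "girth = 2 * q" "R = h + q"
        using False w(3,4) unfolding h_def q_def by simp_all
      have "\<exists>w\<in>V. base w = c \<and> height w = h" if c: "c \<in> cyc" for c
      proof -
        \<comment> \<open>Applied at the antipode of \<open>c\<close>, equality forces a path of
          full height \<open>h\<close> over \<open>c\<close> itself.\<close>
        obtain w k where w: "w \<in> V" "R \<le> height w + k" "2 * k \<le> girth"
          "2 * k = girth \<longrightarrow> base w = (f ^^ k) ((f ^^ q) c)"
          using step[OF cyc_iter[OF c, of q]] by blast
        have "k = q" "height w = h" using w q max[OF w(1)] by (auto simp: h_def)
        moreover have "(f ^^ q) ((f ^^ q) c) = c"
          using iter_girth[OF c] q(1) by (simp add: mult_2 funpow_add)
        ultimately show ?thesis using w q by auto
      qed
      then obtain W where W: "\<And>c. c \<in> cyc \<Longrightarrow> W c \<in> V \<and> base (W c) = c \<and> height (W c) = h"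
        by metis
      show ?thesis
      proof (cases "h = 0")
        case True
        then show ?thesis using hsum_closed_le[OF closed_set_cyc] hsum_cyc q by simp
      next
        case False
        have inj: "inj_on W cyc" using W by (metis inj_onI)
        have "girth / 2 + (\<Sum>x\<in>W ` cyc. height x / 2 - 1 / 5) \<le> hsum (arcs_of V)"
          using W by (intro hsum_ge_orbits) (auto simp: finite_cyc inj_on_def)
        also have "(\<Sum>x\<in>W ` cyc. height x / 2 - 1 / 5) = (\<Sum>c\<in>cyc. real h / 2 - 1 / 5)"
          using W by (subst sum.reindex[OF inj]) auto
        finally have H: "real girth / 2 + real girth * (real h / 2 - 1 / 5) \<le> hsum (arcs_of V)"
          by (simp add: card_cyc)
        \<comment> \<open>An even girth of at least 3 is at least 4, and four paths already yield
          \<open>2 * h - 4/5\<close>, which is at least \<open>h\<close> for positive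
          \<open>h\<close>.\<close>
        have "4 \<le> girth" using q(1) girth_ge3 by presburger
        then have "4 * (real h / 2 - 1 / 5) \<le> real girth * (real h / 2 - 1 / 5)"
          using False by (intro mult_right_mono) auto
        moreover have "real h \<le> 4 * (real h / 2 - 1 / 5)" using False by simp
        ultimately have "real girth / 2 + real h \<le> hsum (arcs_of V)"
          using H by (meson add_left_mono order.trans)
        then show ?thesis using q by simp
      qed
    qed
  qed
qed

end

section \<open>Reduction to unicyclic graphs\<close>

lemma relpow_subset:
  fixes A B :: "('a \<times> 'a) set"
  shows "A \<subseteq> B \<Longrightarrow> A ^^ n \<subseteq> B ^^ n"
  by (induction n) (simp_all add: relcomp_mono)

text \<open>\<open>d\<close> is the distance from \<open>a\<close>, and \<open>p v\<close> precedes
  \<open>v\<close> on a shortest walk.\<close>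

lemma bfs_tree:
  assumes "A \<subseteq> V \<times> V" "sym A" "a \<in> V" "\<And>v. v \<in> V \<Longrightarrow> (a, v) \<in> A\<^sup>*"
  obtains p d where "d a = (0::nat)"
    "\<And>v. v \<in> V \<Longrightarrow> v \<noteq> a \<Longrightarrow> p v \<in> V \<and> (v, p v) \<in> A \<and> d v = Suc (d (p v))"
proof -
  define d where "d v = (LEAST n. (a, v) \<in> A ^^ n)" for v
  have d: "(a, v) \<in> A ^^ d v" if "(a, v) \<in> A ^^ n" for v n
    unfolding d_def using that by (rule LeastI)
  have d_le: "d v \<le> n" if "(a, v) \<in> A ^^ n" for v n
    unfolding d_def using that by (rule Least_le)
  have da: "d a = 0" using d_le[of a 0] by simp
  have "\<exists>y. y \<in> V \<and> (v, y) \<in> A \<and> d v = Suc (d y)" if v: "v \<in> V" "v \<noteq> a" for v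
  proof -
    obtain n where "(a, v) \<in> A ^^ n" using assms(4)[OF v(1)] rtrancl_imp_relpow by blast
    then have dv: "(a, v) \<in> A ^^ d v" by (rule d)
    then obtain m where m: "d v = Suc m" using v(2) by (cases "d v") auto
    then obtain y where y: "(a, y) \<in> A ^^ m" "(y, v) \<in> A" using dv by auto
    have "(a, v) \<in> A ^^ Suc (d y)" using d[OF y(1)] y(2) by auto
    then have "d v \<le> Suc (d y)" by (rule d_le)
    then have "d v = Suc (d y)" using d_le[OF y(1)] m by simp
    then show ?thesis using y assms(1,2) by (auto dest: symD)
  qed
  then obtain p where "\<And>v. v \<in> V \<Longrightarrow> v \<noteq> a \<Longrightarrow> p v \<in> V \<and> (v, p v) \<in> A \<and> d v = Suc (d (p v))"
    by metis
  then show thesis using that da by blast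
qed

text \<open>A spanning tree has fewer than \<open>2 * card V\<close> arcs, so some arc lies outside
  it and its removal leaves the tree intact.\<close>

lemma ex_non_bridge:
  assumes "finite V" "V \<noteq> {}" "A \<subseteq> V \<times> V" "sym A"
    and conn: "\<And>u v. u \<in> V \<Longrightarrow> v \<in> V \<Longrightarrow> (u, v) \<in> A\<^sup>*"
    and card: "2 * card V \<le> card A"
  obtains a b where "(a, b) \<in> A"
    "\<And>u v. u \<in> V \<Longrightarrow> v \<in> V \<Longrightarrow> (u, v) \<in> (A - {(a, b), (b, a)})\<^sup>*"
proof -
  obtain r where r: "r \<in> V" using assms(2) by auto
  obtain p d where pd: "d r = (0::nat)"
    "\<And>v. v \<in> V \<Longrightarrow> v \<noteq> r \<Longrightarrow> p v \<in> V \<and> (v, p v) \<in> A \<and> d v = Suc (d (p v))"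
    using bfs_tree[OF assms(3,4) r] conn r by metis
  define T where "T = (\<lambda>v. (v, p v)) ` (V - {r}) \<union> (\<lambda>v. (p v, v)) ` (V - {r})"
  have "card T \<le> card (V - {r}) + card (V - {r})"
    unfolding T_def using assms(1) by (intro card_Un_le[THEN order.trans] add_mono card_image_le) auto
  moreover have "card (V - {r}) < card V" using r assms(1) by (meson card_Diff1_less)
  ultimately have "card T < card A" using card by linarith
  moreover have "finite T" using assms(1) by (simp add: T_def)
  ultimately obtain a b where ab: "(a, b) \<in> A" "(a, b) \<notin> T"
    by (metis card_mono linorder_not_less subrelI)
  have symT: "sym T" by (auto simp: T_def sym_def)
  have up: "(v, r) \<in> T\<^sup>*" if "v \<in> V" for v
    using that
  proof (induction "d v" arbitrary: v rule: less_induct)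
    case less
    show ?case
    proof (cases "v = r")
      case False
      then have "(v, p v) \<in> T" using less.prems by (auto simp: T_def)
      moreover have "(p v, r) \<in> T\<^sup>*" using less pd(2)[OF less.prems False] by auto
      ultimately show ?thesis by auto
    qed auto
  qed
  have "T \<subseteq> A - {(a, b), (b, a)}"
    using pd(2) ab symT assms(4) by (auto simp: T_def dest: symD)
  then have "(u, v) \<in> (A - {(a, b), (b, a)})\<^sup>*" if "u \<in> V" "v \<in> V" for u v
    using up[OF that(1)] symD[OF sym_rtrancl[OF symT] up[OF that(2)]] rtrancl_mono
    by (meson rtrancl_trans subsetD)
  then show thesis using that ab by blast
qed

text \<open>Remove the extra edges one at a time. \<open>B\<close> survives and keeps the ends
  connected, so \<open>hsum_add_cycle_edge\<close> applies; halving turns arcs into edges.\<close>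

lemma hsum_supergraph:
  assumes "finite A" "sym A" "irrefl A" "B \<subseteq> A" "sym B" "A \<subseteq> V \<times> V"
    and "\<And>u v. u \<in> V \<Longrightarrow> v \<in> V \<Longrightarrow> (u, v) \<in> B\<^sup>*"
  shows "hsum B - 31 / 105 * ((real (card A) - real (card B)) / 2) \<le> hsum A"
  using assms
proof (induction "card A" arbitrary: A rule: less_induct)
  case less
  show ?case
  proof (cases "A = B")
    case False
    then obtain u v where uv: "(u, v) \<in> A" "(u, v) \<notin> B" using less.prems by auto
    then have vu: "(v, u) \<in> A" "(v, u) \<notin> B" using less.prems by (auto dest: symD)
    have ne: "u \<noteq> v" using uv less.prems by (auto simp: irrefl_def)
    define A' where "A' = A - {(u, v), (v, u)}"
    have A: "A = add_edge u v A'" using uv vu by (auto simp: add_edge_def A'_def)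
    have A': "finite A'" "sym A'" "irrefl A'" "B \<subseteq> A'" "A' \<subseteq> V \<times> V"
      using less.prems uv vu by (auto simp: A'_def irrefl_def sym_def)
    have "card A' = card A - card {(u, v), (v, u)}"
      unfolding A'_def using uv vu by (intro card_Diff_subset) auto
    moreover have "card {(u, v), (v, u)} = 2" using ne by simp
    moreover have "card {(u, v), (v, u)} \<le> card A"
      using uv vu less.prems(1) by (intro card_mono) auto
    ultimately have card: "card A = card A' + 2" by linarith
    have "(u, v) \<in> B\<^sup>*" using uv less.prems by blast
    then have "(u, v) \<in> A'\<^sup>*" using A'(4) rtrancl_mono by blast
    then have "hsum A' - 31 / 105 \<le> hsum A"
      unfolding A using A' ne by (intro hsum_add_cycle_edge) (auto simp: A'_def)
    moreover have "hsum B - 31 / 105 * ((real (card A') - real (card B)) / 2) \<le> hsum A'"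
      using card by (intro less.hyps[OF _ A'(1-4) less.prems(5) A'(5) less.prems(7)]) simp_all
    moreover have "real (card A) = real (card A') + 2" using card by simp
    ultimately show ?thesis by argo
  qed simp
qed

lemma (in functional_graph) card_arcs_of: "card (arcs_of V) = 2 * card V"
proof -
  have "card (arcs_of V) = card ((\<lambda>v. (v, f v)) ` V) + card ((\<lambda>v. (f v, v)) ` V)"
    unfolding arcs_of_def using finite_V f_f_neq by (intro card_Un_disjoint) auto
  then show ?thesis by (simp add: card_image inj_on_def)
qed

lemma hsum_lower_bound:
  assumes "finite V" "V \<noteq> {}" "A \<subseteq> V \<times> V" "sym A" "irrefl A"
    and conn: "\<And>u v. u \<in> V \<Longrightarrow> v \<in> V \<Longrightarrow> (u, v) \<in> A\<^sup>*"
    and card: "2 * card V \<le> card A"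
    and far: "\<And>u. u \<in> V \<Longrightarrow> \<exists>w\<in>V. \<forall>n. (u, w) \<in> A ^^ n \<longrightarrow> R \<le> n"
  shows "real R - 31 / 105 * (real (card A) / 2 - real (card V)) \<le> hsum A"
proof -
  obtain a b where ab: "(a, b) \<in> A"
    "\<And>u v. u \<in> V \<Longrightarrow> v \<in> V \<Longrightarrow> (u, v) \<in> (A - {(a, b), (b, a)})\<^sup>*"
    using ex_non_bridge[OF assms(1-4) conn card] by blast
  let ?A = "A - {(a, b), (b, a)}"
  have V: "a \<in> V" "b \<in> V" and ne: "a \<noteq> b" and ba: "(b, a) \<in> A"
    using ab(1) assms(3-5) by (auto simp: irrefl_def dest: symD)
  have sub: "?A \<subseteq> V \<times> V" "sym ?A" using assms(3,4) by (auto simp: sym_def)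
  obtain p d where pd: "d a = (0::nat)"
    "\<And>v. v \<in> V \<Longrightarrow> v \<noteq> a \<Longrightarrow> p v \<in> V \<and> (v, p v) \<in> ?A \<and> d v = Suc (d (p v))"
    using bfs_tree[OF sub V(1) ab(2)[OF V(1)]] by metis
  \<comment> \<open>The tree avoids the edge \<open>ab\<close>; sending the root to \<open>b\<close>
    restores it and closes the cycle.\<close>
  define f where "f = p(a := b)"
  \<comment> \<open>As \<open>ab\<close> was deleted, the parent of \<open>b\<close> is not the
    root.\<close>
  have "2 \<le> d b"
  proof -
    have pb: "p b \<in> V" "(b, p b) \<in> ?A" "d b = Suc (d (p b))" using pd(2)[OF V(2)] ne by auto
    then have "p b \<noteq> a" by auto
    then show ?thesis using pd(2)[OF pb(1)] pb(3) by simp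
  qed
  then interpret functional_graph V f a d
    using assms(1) V pd by unfold_locales (auto simp: f_def)
  have B: "arcs_of V \<subseteq> A"
  proof -
    have "(v, f v) \<in> A" if "v \<in> V" for v using pd(2)[OF that] ab(1) by (auto simp: f_def)
    then show ?thesis using assms(4) by (auto simp: arcs_of_def dest: symD)
  qed
  have "(u, v) \<in> (arcs_of V)\<^sup>*" if "u \<in> V" "v \<in> V" for u v
    using walk_meet[OF that, of "d u" "d v"] iter_d that relpow_imp_rtrancl by metis
  then have "hsum (arcs_of V) - 31 / 105 * ((real (card A) - real (card (arcs_of V))) / 2) \<le> hsum A"
    using assms B sym_arcs_of finite_subset[OF assms(3)] by (intro hsum_supergraph[of A _ V]) auto
  moreover have "real R \<le> hsum (arcs_of V)"
  proof (rule hsum_ge_radius)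
    fix u assume "u \<in> V"
    then show "\<exists>w\<in>V. \<forall>n. (u, w) \<in> arcs_of V ^^ n \<longrightarrow> R \<le> n"
      using far[of u] relpow_subset[OF B] by blast
  qed
  ultimately show ?thesis by (simp add: card_arcs_of field_simps)
qed

section \<open>Pair graphs\<close>

lemma out_degree_eq_deg:
  "out_degree (with_proj G) v = deg (parcs G) v"
proof -
  have "bij_betw snd (out_arcs (with_proj G) v) (parcs G `` {v})"
    by (rule bij_betw_byWitness[where f' = "\<lambda>y. (v, y)"]) (auto simp: out_arcs_def)
  then show ?thesis by (simp add: out_degree_def deg_def bij_betw_same_card)
qed

context pair_graph
begin

lemma sym_parcs: "sym (parcs G)"
  using arcs_symmetric by (auto simp: sym_def)

lemma irrefl_parcs: "irrefl (parcs G)"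
  unfolding irrefl_def using no_loops' by blast

text \<open>Group the arcs by their underlying edge: each fibre consists of two opposite
  arcs.\<close>

lemma sum_parcs_eq_sum_uedges:
  fixes w :: "'a \<Rightarrow> 'a \<Rightarrow> real" and W :: "'a set \<Rightarrow> real"
  assumes "\<And>x y. (x, y) \<in> parcs G \<Longrightarrow> w x y + w y x = W {x, y}"
  shows "(\<Sum>(x, y)\<in>parcs G. w x y) = sum W (uedges G)"
proof -
  have U: "uedges G = (\<lambda>(x, y). {x, y}) ` parcs G" by (auto simp: uedges_def image_def)
  have "(\<Sum>p\<in>{p \<in> parcs G. (\<lambda>(x, y). {x, y}) p = e}. (\<lambda>(x, y). w x y) p) = W e"
    if "e \<in> uedges G" for e
  proof -
    obtain x y where xy: "(x, y) \<in> parcs G" "e = {x, y}" using \<open>e \<in> uedges G\<close> by (auto simp: uedges_def)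
    have "x \<noteq> y" by (rule no_loops'[OF xy(1)])
    have "(y, x) \<in> parcs G" by (rule arcs_symmetric[OF xy(1)])
    have "{p \<in> parcs G. (\<lambda>(x, y). {x, y}) p = e} = {(x, y), (y, x)}"
    proof (rule set_eqI)
      fix p
      show "p \<in> {p \<in> parcs G. (\<lambda>(x, y). {x, y}) p = e} \<longleftrightarrow> p \<in> {(x, y), (y, x)}"
        using xy(1) \<open>(y, x) \<in> parcs G\<close>
        by (cases p) (auto simp only: xy(2) doubleton_eq_iff mem_Collect_eq prod.case insert_iff
            empty_iff prod.inject)
    qed
    then show ?thesis using assms[OF xy(1)] \<open>x \<noteq> y\<close> xy(2) by simp
  qed
  then show ?thesis
    using sum.group[OF pair_finite_arcs, of "uedges G" "\<lambda>(x, y). {x, y}" "\<lambda>(x, y). w x y"]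
      pair_finite_arcs by (simp add: U)
qed

lemma harmonic_index_eq_hsum: "harmonic_index G = hsum (parcs G)"
  unfolding harmonic_index_def hsum_def
proof (rule sum_parcs_eq_sum_uedges[symmetric])
  fix x y assume "(x, y) \<in> parcs G"
  then have "x \<noteq> y" by (rule no_loops')
  then show "1 / (real (deg (parcs G) x) + real (deg (parcs G) y))
      + 1 / (real (deg (parcs G) y) + real (deg (parcs G) x))
      = 2 / (\<Sum>v\<in>{x, y}. real (out_degree G v))"
    by (simp add: out_degree_eq_deg add.commute)
qed

lemma card_parcs: "card (parcs G) = 2 * card (uedges G)"
proof -
  have "(\<Sum>(x, y)\<in>parcs G. 1) = (\<Sum>e\<in>uedges G. 2 :: real)"
    by (rule sum_parcs_eq_sum_uedges) simp
  then show ?thesis by (simp add: case_prod_unfold)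
qed

lemma ex_awalk_of_relpow:
  "u \<in> pverts G \<Longrightarrow> (u, w) \<in> parcs G ^^ n \<Longrightarrow> \<exists>p. awalk u p w \<and> length p = n"
proof (induction n arbitrary: w)
  case 0
  then show ?case by (auto simp: awalk_Nil_iff)
next
  case (Suc n)
  then obtain z where z: "(u, z) \<in> parcs G ^^ n" "(z, w) \<in> parcs G" by auto
  then obtain p where "awalk u p z" "length p = n" using Suc by blast
  then have "awalk u (p @ [(z, w)]) w \<and> length (p @ [(z, w)]) = Suc n"
    using arc_implies_awalk[OF z(2)] awalk_appendI by auto
  then show ?case by blast
qed

text \<open>Used in the other direction: a large distance forces every walk to be long.\<close>

lemma graph_dist_le:
  assumes "u \<in> pverts G" "(u, w) \<in> parcs G ^^ n"
  shows "graph_dist G u w \<le> real n"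
proof -
  have cost: "awalk_cost (\<lambda>_. 1) p = real (length p)" for p
    by (induction p) auto
  obtain p where "awalk u p w" "length p = n" using ex_awalk_of_relpow[OF assms] by blast
  then have "\<mu> (\<lambda>_. 1) u w \<le> ereal (real n)"
    using min_cost_le_walk_cost[of u p w "\<lambda>_. 1"] cost[of p] by simp
  moreover have "0 \<le> \<mu> (\<lambda>_. 1) u w"
    unfolding \<mu>_def by (rule INF_greatest) (simp add: cost)
  ultimately show ?thesis
    unfolding graph_dist_def by (cases "\<mu> (\<lambda>_. 1) u w") auto
qed

lemma graph_radius_attained:
  assumes "u \<in> pverts G"
  shows "\<exists>w\<in>pverts G. graph_radius G \<le> graph_dist G u w"
proof -
  have "graph_radius G \<le> Max (graph_dist G u ` pverts G)"
    unfolding graph_radius_def using assms pair_finite_verts by (intro Min_le) auto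
  moreover have "Max (graph_dist G u ` pverts G) \<in> graph_dist G u ` pverts G"
    using assms pair_finite_verts by (intro Max_in) auto
  ultimately show ?thesis by auto
qed

end

theorem theorem3:
  fixes G :: "'a pair_pre_digraph"
  assumes "pair_graph G"
    and "Digraph_Component.connected G"
    and "cyclomatic_number G \<ge> 1"
  shows "harmonic_index G \<ge> graph_radius G - 31 / 105 * real_of_int (cyclomatic_number G - 1)
    \<and> (cyclomatic_number G \<le> 4 \<longrightarrow> harmonic_index G > graph_radius G - 1)"
proof -
  interpret pair_graph G by fact
  have sc: "strongly_connected G"
    using symmetric_connected_imp_strongly_connected[OF sym_arcs assms(2)] .
  have ne: "pverts G \<noteq> {}" using sc by (simp add: strongly_connected_def)
  have conn: "(u, v) \<in> (parcs G)\<^sup>*" if "u \<in> pverts G" "v \<in> pverts G" for u v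
    using sc that reachable_rtranclI[of "with_proj G" u v] by (simp add: strongly_connected_def)
  have le: "2 * card (pverts G) \<le> card (parcs G)"
    using assms(3) by (simp add: card_parcs cyclomatic_number_def)
  have k: "real (card (parcs G)) / 2 - real (card (pverts G)) = real_of_int (cyclomatic_number G - 1)"
    by (simp add: card_parcs cyclomatic_number_def)
  \<comment> \<open>Walk lengths are integers, so the radius may be rounded up to a natural
    number.\<close>
  have "real (nat \<lceil>graph_radius G\<rceil>)
      - 31 / 105 * (real (card (parcs G)) / 2 - real (card (pverts G))) \<le> hsum (parcs G)"
  proof (rule hsum_lower_bound[OF pair_finite_verts ne _ sym_parcs irrefl_parcs conn le])
    show "parcs G \<subseteq> pverts G \<times> pverts G" using wellformed' by auto
    fix u assume u: "u \<in> pverts G"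
    then obtain w where w: "w \<in> pverts G" "graph_radius G \<le> graph_dist G u w"
      using graph_radius_attained by blast
    have "nat \<lceil>graph_radius G\<rceil> \<le> n" if "(u, w) \<in> parcs G ^^ n" for n
      using graph_dist_le[OF u that] w(2) by (simp add: ceiling_le_iff)
    then show "\<exists>w\<in>pverts G. \<forall>n. (u, w) \<in> parcs G ^^ n \<longrightarrow> nat \<lceil>graph_radius G\<rceil> \<le> n"
      using w(1) by blast
  qed
  then have main: "graph_radius G - 31 / 105 * real_of_int (cyclomatic_number G - 1) \<le> harmonic_index G"
    using real_nat_ceiling_ge[of "graph_radius G"] unfolding k harmonic_index_eq_hsum by linarith
  have "graph_radius G - 1 < harmonic_index G" if "cyclomatic_number G \<le> 4"
  proof -
    have "31 / 105 * real_of_int (cyclomatic_number G - 1) \<le> 31 / 105 * 3"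
      using that by (intro mult_left_mono) auto
    also have "\<dots> < (1 :: real)" by simp
    finally show ?thesis using main by argo
  qed
  with main show ?thesis by blast
qed

end
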